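(* Let $n\ge4$ and let $\varphi$ be a $\frac12$-derivation of the Lie algebra $\mathfrak{s}^{3}_{n,1}$. Then there are complex numbers $\alpha_1,\alpha_3,\dots,\alpha_n,\delta_n$ such that $$\varphi(e_1)=\alpha_1e_1+\sum_{i=3}^n\alpha_ie_i,\quad \varphi(e_i)=\alpha_1e_i\ (2\le i\le n),\quad \varphi(x)=\sum_{i=3}^{n-1}(i-2)\alpha_{i+1}e_i+\delta_ne_n+\alpha_1x.$$
   Context: All algebras are over $\mathbb{C}$. A $\frac12$-derivation of a Lie algebra $(\mathfrak{L},[-,-])$ is a linear map $\varphi:\mathfrak{L}\to\mathfrak{L}$ with $\varphi([u,v])=\frac12([\varphi(u),v]+[u,\varphi(v)])$ for all $u,v\in\mathfrak{L}$. $\mathfrak{s}^{3}_{n,1}$ is the $(n+1)$-dimensional Lie algebra with basis $e_1,\dots,e_n,x$ and brackets $[e_i,e_1]=e_{i+1}$ for $2\le i\le n-1$; $[e_1,x]=e_1+e_2$; $[e_i,x]=(i-1)e_i$ for $2\le i\le n$; brackets of basis elements not determined by these and antisymmetry are zero. *)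

theory Defs
  imports "HOL-Analysis.Analysis"
begin

locale complex_lie_algebra = vector_space scale
  for scale :: "complex \<Rightarrow> 'a::ab_group_add \<Rightarrow> 'a" +
  fixes bracket :: "'a \<Rightarrow> 'a \<Rightarrow> 'a"
  assumes linear_right: "\<And>u. Vector_Spaces.linear scale scale (\<lambda>v. bracket u v)"
    and linear_left: "\<And>v. Vector_Spaces.linear scale scale (\<lambda>u. bracket u v)"
    and alternating: "\<And>u. bracket u u = 0"
    and jacobi: "\<And>u v w. bracket u (bracket v w) + bracket v (bracket w u)
                    + bracket w (bracket u v) = 0"
begin

definition half_derivation :: "('a \<Rightarrow> 'a) \<Rightarrow> bool" where
  "half_derivation \<phi> \<longleftrightarrow> Vector_Spaces.linear scale scale \<phi> \<and>
     (\<forall>u v. \<phi> (bracket u v) = scale (1/2) (bracket (\<phi> u) v + bracket u (\<phi> v)))"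

end

text \<open>
  The solvable Lie algebra \<open>s\<^sup>3\<^bsub>n,1\<^esub>\<close>, given by an indexed basis \<open>e 1, \<dots>, e n, x\<close> of the whole
  type and its multiplication table. Values of \<open>e\<close> outside \<open>{1..n}\<close> are irrelevant. The brackets
  \<open>[e\<^sub>1, e\<^sub>1]\<close>, \<open>[x, x]\<close> and those with exchanged arguments follow from \<open>alternating\<close>.
\<close>

locale lie_s3 = complex_lie_algebra scale bracket
  for scale :: "complex \<Rightarrow> 'a::ab_group_add \<Rightarrow> 'a"
    and bracket :: "'a \<Rightarrow> 'a \<Rightarrow> 'a" +
  fixes n :: nat and e :: "nat \<Rightarrow> 'a" and x :: 'a
  assumes basis_inj: "inj_on e {1..n}"
    and basis_x: "x \<notin> e ` {1..n}"
    and basis_independent: "independent (insert x (e ` {1..n}))"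
    and basis_span: "span (insert x (e ` {1..n})) = UNIV"
    and bracket_ei_e1: "\<And>i. 2 \<le> i \<Longrightarrow> i < n \<Longrightarrow> bracket (e i) (e 1) = e (i + 1)"
    and bracket_en_e1: "2 \<le> n \<Longrightarrow> bracket (e n) (e 1) = 0"
    and bracket_ei_ej: "\<And>i j. 2 \<le> i \<Longrightarrow> i \<le> n \<Longrightarrow> 2 \<le> j \<Longrightarrow> j \<le> n \<Longrightarrow> bracket (e i) (e j) = 0"
    and bracket_e1_x: "bracket (e 1) x = e 1 + e 2"
    and bracket_ei_x: "\<And>i. 2 \<le> i \<Longrightarrow> i \<le> n \<Longrightarrow> bracket (e i) x = scale (of_nat i - 1) (e i)"

text \<open>
  The algebra exists in every dimension \<open>n + 1 \<ge> 3\<close>. In the model the coordinate of \<open>x\<close> is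
  indexed by \<open>0\<close> and that of \<open>e i\<close> by \<open>i\<close>.
\<close>

definition s3_coord :: "(nat \<Rightarrow> complex) \<Rightarrow> (nat \<Rightarrow> complex) \<Rightarrow> nat \<Rightarrow> complex" where
  "s3_coord u v k =
     (if k = 0 then 0
      else if k = 1 then u 1 * v 0 - u 0 * v 1
      else if k = 2 then (u 1 * v 0 - u 0 * v 1) + (u 2 * v 0 - u 0 * v 2)
      else (of_nat k - 1) * (u k * v 0 - u 0 * v k) + (u (k - 1) * v 1 - u 1 * v (k - 1)))"

lemma s3_coord_cong:
  assumes "\<And>i. i \<le> k \<Longrightarrow> u i = u' i" "\<And>i. i \<le> k \<Longrightarrow> v i = v' i"
  shows "s3_coord u v k = s3_coord u' v' k"
  using assms by (auto simp: s3_coord_def)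

lemma s3_coord_zero:
  assumes "u 0 = 0" "u 1 = 0" "v 0 = 0" "v 1 = 0"
  shows "s3_coord u v k = 0"
  unfolding s3_coord_def assms by simp

lemma s3_coord_x:
  assumes "u 0 = 0" "u 1 = 0" "v 0 = 1" "\<And>i. i \<ge> 1 \<Longrightarrow> v i = 0"
  shows "s3_coord u v k = (of_nat k - 1) * u k"
  using assms by (simp add: s3_coord_def)

lemma s3_coord_jacobi:
  "s3_coord u (s3_coord v w) k + s3_coord v (s3_coord w u) k + s3_coord w (s3_coord u v) k = 0"
proof -
  consider "k = 0" | "k = 1" | "k = 2" | "k = 3" | m where "k = m + 4"
  proof -
    have "k = 0 \<or> k = 1 \<or> k = 2 \<or> k = 3 \<or> (\<exists>m. k = m + 4)" by presburger
    then show thesis using that by blast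
  qed
  then show ?thesis
    by cases (simp_all add: s3_coord_def algebra_simps)
qed

lemma lie_s3_exists:
  assumes n: "n \<ge> 2" and card: "CARD('m::finite) = n + 1"
  shows "\<exists>bracket e x. lie_s3 ((*s) :: complex \<Rightarrow> complex^'m \<Rightarrow> complex^'m) bracket n e x"
proof -
  obtain f :: "'m \<Rightarrow> nat" where f: "bij_betw f UNIV {0..<n + 1}"
    using ex_bij_betw_finite_nat[of "UNIV :: 'm set"] card by auto
  define g where "g = inv_into UNIV f"
  have fg: "f (g k) = k" if "k \<le> n" for k
    using that f unfolding g_def by (simp add: bij_betw_inv_into_right)
  have gf: "g (f m) = m" for m
    using f unfolding g_def by (simp add: bij_betw_inv_into_left)
  have f_le: "f m \<le> n" for m
    using bij_betwE[OF f] by (auto simp: less_Suc_eq_le)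
  have g_eq: "g i = m \<longleftrightarrow> f m = i" if "i \<le> n" for i m
    using that fg gf by blast
  define br :: "complex^'m \<Rightarrow> complex^'m \<Rightarrow> complex^'m" where
    "br u v = (\<chi> m. s3_coord (\<lambda>k. u $ g k) (\<lambda>k. v $ g k) (f m))" for u v
  define E :: "nat \<Rightarrow> complex^'m" where "E i = axis (g i) 1" for i
  have E_nth: "E i $ g k = (if i = k then 1 else 0)" if "i \<le> n" "k \<le> n" for i k
    using that g_eq fg by (auto simp: E_def axis_def)
  have E_nth': "E i $ m = (if i = f m then 1 else 0)" if "i \<le> n" for i m
    using E_nth[OF that f_le[of m]] gf by simp
  have br_E: "br (E i) (E j) $ m =
      s3_coord (\<lambda>k. if i = k then 1 else 0) (\<lambda>k. if j = k then 1 else 0) (f m)"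
    if "i \<le> n" "j \<le> n" for i j m
    unfolding br_def using that f_le[of m] by (auto intro!: s3_coord_cong simp: E_nth)
  have br_br: "br u (br v w) $ m = s3_coord (\<lambda>k. u $ g k)
      (s3_coord (\<lambda>k. v $ g k) (\<lambda>k. w $ g k)) (f m)" for u v w m
    unfolding br_def using f_le[of m] by (auto intro!: s3_coord_cong simp: fg)
  have "range (\<lambda>m. E (f m)) = cart_basis"
    by (auto simp: cart_basis_def E_def gf)
  moreover have "range (\<lambda>m. E (f m)) = E ` {0..n}"
    using f by (auto simp: bij_betw_def image_image[symmetric] atLeastLessThanSuc_atLeastAtMost)
  moreover have "{0..n} = insert 0 {1..n}" by auto
  ultimately have basis: "insert (E 0) (E ` {1..n}) = cart_basis"
    by simp
  have inj: "inj_on E {0..n}"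
    using g_eq fg by (auto simp: inj_on_def E_def axis_eq_axis)
  have "lie_s3 ((*s) :: complex \<Rightarrow> complex^'m \<Rightarrow> complex^'m) br n E (E 0)"
  proof unfold_locales
    fix u v w :: "complex^'m" and c d :: complex
    show "br u (v + w) = br u v + br u w" "br u (c *s v) = c *s br u v"
      "br (v + w) u = br v u + br w u" "br (c *s v) u = c *s br v u" "br u u = 0"
      by (auto simp: br_def vec_eq_iff s3_coord_def algebra_simps)
    show "br u (br v w) + br v (br w u) + br w (br u v) = 0"
      by (simp add: vec_eq_iff br_br s3_coord_jacobi)
  next
    show "inj_on E {1..n}" using inj by (rule inj_on_subset) auto
    show "E 0 \<notin> E ` {1..n}" using inj_onD[OF inj, of 0] by force
    show "vec.independent (insert (E 0) (E ` {1..n}))"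
      unfolding basis by (rule independent_cart_basis)
    show "vec.span (insert (E 0) (E ` {1..n})) = UNIV"
      unfolding basis by (rule span_cart_basis)
    show "br (E n) (E 1) = 0" using n
    proof -
      have "f m - 1 \<noteq> n" for m using f_le[of m] n by linarith
      then show ?thesis using n by (auto simp: vec_eq_iff br_E s3_coord_def)
    qed
    show "br (E 1) (E 0) = E 1 + E 2" using n
      by (auto simp: vec_eq_iff br_E E_nth' s3_coord_def)
  next
    fix i assume i: "2 \<le> i" "i < n"
    show "br (E i) (E 1) = E (i + 1)" using i
      by (auto simp: vec_eq_iff br_E E_nth' s3_coord_def)
  next
    fix i j :: nat assume ij: "2 \<le> i" "i \<le> n" "2 \<le> j" "j \<le> n"
    have "s3_coord (\<lambda>k. if i = k then 1 else 0) (\<lambda>k. if j = k then 1 else 0) k = 0" for k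
      by (rule s3_coord_zero) (use ij in auto)
    with ij show "br (E i) (E j) = 0"
      by (simp only: vec_eq_iff br_E zero_index simp_thms)
  next
    fix i :: nat assume i: "2 \<le> i" "i \<le> n"
    have "s3_coord (\<lambda>k. if i = k then 1 else 0) (\<lambda>k. if 0 = k then 1 else 0) k
        = (of_nat k - 1) * (if i = k then 1 else 0)" for k
      by (rule s3_coord_x) (use i in auto)
    moreover have "(of_nat k - 1) * (if i = k then 1 else 0) =
        (of_nat i - 1) * (if i = k then 1 else 0 :: complex)" for k
      by simp
    ultimately show "br (E i) (E 0) = (of_nat i - 1) *s E i"
      using i by (simp only: vec_eq_iff br_E E_nth' vector_smult_component simp_thms le0)
  qed
  then show ?thesis by blast
qed

end

theory Submission
  imports Defs
begin

text \<open>
  Compare coefficients in the half-derivation identity, with \<open>q\<close> the \<open>x\<close>-coefficient of \<open>\<phi> x\<close>.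
  The brackets \<open>[e\<^sub>i, x]\<close> force \<open>\<phi> e\<^sub>i = q e\<^sub>i + c\<^sub>i e\<^bsub>2i-1\<^esub>\<close>, the eigenvalue of \<open>e\<^bsub>2i-1\<^esub>\<close> being twice
  that of \<open>e\<^sub>i\<close>. The bracket \<open>[e\<^sub>2, e\<^sub>1] = e\<^sub>3\<close> gives \<open>c\<^sub>2 = 0\<close>, kills the \<open>x\<close>-coefficient of \<open>\<phi> e\<^sub>1\<close>
  and makes its \<open>e\<^sub>1\<close>-coefficient \<open>q\<close>, so \<open>\<phi> e\<^sub>i = q e\<^sub>i\<close> follows by induction from
  \<open>[e\<^sub>i, e\<^sub>1] = e\<^bsub>i+1\<^esub>\<close>. The bracket \<open>[e\<^sub>1, x]\<close> then determines \<open>\<phi> x\<close> up to its \<open>e\<^sub>n\<close>-coefficient.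
\<close>

section \<open>Bilinearity of the coordinate formula and of the bracket\<close>

lemma s3_coord_add_left:
  "s3_coord (\<lambda>i. u i + u' i) v k = s3_coord u v k + s3_coord u' v k"
  by (simp add: s3_coord_def algebra_simps)

lemma s3_coord_add_right:
  "s3_coord u (\<lambda>i. v i + v' i) k = s3_coord u v k + s3_coord u v' k"
  by (simp add: s3_coord_def algebra_simps)

lemma s3_coord_scale_left: "s3_coord (\<lambda>i. c * u i) v k = c * s3_coord u v k"
  by (simp add: s3_coord_def algebra_simps)

lemma s3_coord_scale_right: "s3_coord u (\<lambda>i. c * v i) k = c * s3_coord u v k"
  by (simp add: s3_coord_def algebra_simps)

context complex_lie_algebra
begin

lemma bracket_add_right: "bracket u (v + w) = bracket u v + bracket u w"
  using linear_right by (simp add: Vector_Spaces.linear_iff)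

lemma bracket_add_left: "bracket (u + v) w = bracket u w + bracket v w"
  using linear_left by (simp add: Vector_Spaces.linear_iff)

lemma bracket_scale_right: "bracket u (scale c v) = scale c (bracket u v)"
  using linear_right by (simp add: Vector_Spaces.linear_iff)

lemma bracket_scale_left: "bracket (scale c u) v = scale c (bracket u v)"
  using linear_left by (simp add: Vector_Spaces.linear_iff)

lemma bracket_anticomm: "bracket u v = - bracket v u"
proof -
  have "bracket u v + bracket v u = bracket (u + v) (u + v)"
    unfolding bracket_add_left bracket_add_right by (simp add: alternating)
  also have "\<dots> = 0"
    by (rule alternating)
  finally show ?thesis
    by (rule eq_neg_iff_add_eq_0[THEN iffD2])
qed

end

section \<open>Coordinates in the given basis\<close>

context lie_s3
begin

text \<open>Index 0 for x is the convention of \<open>s3_coord\<close>.\<close>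

definition basis :: "nat \<Rightarrow> 'a" where
  "basis k = (if k = 0 then x else e k)"

lemma basis_image: "basis ` {..n} = insert x (e ` {1..n})"
proof -
  have "{..n} = insert 0 {1..n}" by auto
  then show ?thesis by (auto simp: basis_def)
qed

lemma independent_basis: "independent (basis ` {..n})"
  unfolding basis_image by (rule basis_independent)

lemma span_basis: "span (basis ` {..n}) = UNIV"
  unfolding basis_image by (rule basis_span)

lemma inj_on_basis: "inj_on basis {..n}"
  unfolding inj_on_def
proof (intro ballI impI)
  fix i j assume "i \<in> {..n}" "j \<in> {..n}" "basis i = basis j"
  then show "i = j"
    using inj_onD[OF basis_inj, of i j] basis_x
    by (cases "i = 0"; cases "j = 0") (force simp: basis_def)+
qed

definition coord :: "nat \<Rightarrow> 'a \<Rightarrow> complex" where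
  "coord k u = representation (basis ` {..n}) u (basis k)"

lemma coord_add: "coord k (u + v) = coord k u + coord k v"
  using independent_basis by (simp add: coord_def span_basis representation_add)

lemma coord_scale: "coord k (scale c u) = c * coord k u"
  using independent_basis by (simp add: coord_def span_basis representation_scale)

lemma coord_neg: "coord k (- u) = - coord k u"
  using independent_basis by (simp add: coord_def span_basis representation_neg)

lemma coord_zero: "coord k 0 = 0"
  by (simp add: coord_def representation_zero)

lemma coord_sum: "coord k (\<Sum>i\<in>A. f i) = (\<Sum>i\<in>A. coord k (f i))"
  by (induction A rule: infinite_finite_induct) (simp_all add: coord_add coord_zero)

lemma coord_basis:
  assumes "i \<le> n" "k \<le> n"
  shows "coord k (basis i) = (if i = k then 1 else 0)"
proof -
  have "basis i \<in> basis ` {..n}"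
    using assms by blast
  then show ?thesis
    using independent_basis assms inj_onD[OF inj_on_basis, of i k]
    by (auto simp: coord_def representation_basis)
qed

lemma coord_e:
  assumes "1 \<le> i" "i \<le> n" "k \<le> n"
  shows "coord k (e i) = (if i = k then 1 else 0)"
  using coord_basis[of i k] assms by (simp add: basis_def)

lemma coord_x: "k \<le> n \<Longrightarrow> coord k x = (if k = 0 then 1 else 0)"
  using coord_basis[of 0 k] by (simp add: basis_def)

lemma coord_sum_e:
  assumes "A \<subseteq> {1..n}" "k \<le> n"
  shows "coord k (\<Sum>i\<in>A. scale (c i) (e i)) = (if k \<in> A then c k else 0)"
proof -
  have "finite A" using assms finite_subset by blast
  moreover have "coord k (\<Sum>i\<in>A. scale (c i) (e i)) = (\<Sum>i\<in>A. if i = k then c i else 0)"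
    unfolding coord_sum using assms by (intro sum.cong) (auto simp: coord_scale coord_e)
  ultimately show ?thesis by simp
qed

lemma coord_eqI:
  assumes "\<And>k. k \<le> n \<Longrightarrow> coord k u = coord k v"
  shows "u = v"
proof -
  let ?B = "basis ` {..n}"
  have "representation ?B u b = representation ?B v b" for b
  proof (cases "b \<in> ?B")
    case True
    then show ?thesis using assms by (auto simp: coord_def)
  next
    case False
    then show ?thesis using representation_ne_zero by metis
  qed
  then have "representation ?B u = representation ?B v" by blast
  moreover have "(\<Sum>b | representation ?B w b \<noteq> 0. scale (representation ?B w b) b) = w" for w
    using sum_nonzero_representation_eq[OF independent_basis] span_basis by auto
  ultimately show ?thesis by metis
qed

lemma basis_induct [case_names basis add scale]:
  assumes "\<And>i. i \<le> n \<Longrightarrow> P (basis i)"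
    and add: "\<And>u v. P u \<Longrightarrow> P v \<Longrightarrow> P (u + v)"
    and scale: "\<And>c u. P u \<Longrightarrow> P (scale c u)"
  shows "P u"
proof -
  have "u \<in> span (basis ` {..n})"
    by (simp add: span_basis)
  then show ?thesis
  proof (induction rule: span_induct_alt)
    case base
    \<comment> \<open>The zero vector is reached as 0 times a basis vector.\<close>
    show ?case using scale[of "basis 0" 0] assms(1)[of 0] by simp
  next
    case (step c b v)
    then show ?case using assms by blast
  qed
qed

section \<open>The bracket in coordinates\<close>

lemma coord_bracket_basis:
  assumes n: "2 \<le> n" and "i \<le> n" "j \<le> n" "k \<le> n"
  shows "coord k (bracket (basis i) (basis j))
    = s3_coord (\<lambda>l. coord l (basis i)) (\<lambda>l. coord l (basis j)) k"
proof -
  let ?\<delta> = "\<lambda>i l. if i = l then 1 else 0 :: complex"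
  \<comment> \<open>Both sides are antisymmetric, so the table is checked only for
    \<open>j < i\<close>.\<close>
  have le: "coord k (bracket (basis i) (basis j)) = s3_coord (?\<delta> i) (?\<delta> j) k"
    if "j < i" "i \<le> n" for i j
  proof -
    consider "j = 0" "i = 1" | "j = 0" "2 \<le> i" | "j = 1" "2 \<le> i" "i < n" | "j = 1" "2 \<le> i" "i = n"
      | "2 \<le> j" "2 \<le> i"
      using \<open>j < i\<close> \<open>i \<le> n\<close> by linarith
    then show ?thesis
      by cases (use that n \<open>k \<le> n\<close> in \<open>auto simp: basis_def bracket_e1_x bracket_ei_x bracket_ei_e1
        bracket_en_e1 bracket_ei_ej coord_add coord_scale coord_e coord_zero s3_coord_def
        simp del: One_nat_def\<close>)
  qed
  have anti: "s3_coord u v k = - s3_coord v u k" for u v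
    by (simp add: s3_coord_def algebra_simps)
  have "coord k (bracket (basis i) (basis j)) = s3_coord (?\<delta> i) (?\<delta> j) k"
  proof (cases i j rule: linorder_cases)
    case less
    then show ?thesis
      using le[of i j] assms anti[of "?\<delta> i"] bracket_anticomm[of "basis i"] by (simp add: coord_neg)
  next
    case equal
    then show ?thesis by (simp add: alternating coord_zero s3_coord_def)
  next
    case greater
    then show ?thesis using le assms by blast
  qed
  also have "\<dots> = s3_coord (\<lambda>l. coord l (basis i)) (\<lambda>l. coord l (basis j)) k"
    \<comment> \<open>\<open>s3_coord\<close> at \<open>k\<close> reads no index above
      \<open>k\<close>, so values of \<open>coord\<close> beyond \<open>n\<close> never
      enter.\<close>
    by (rule s3_coord_cong) (use assms in \<open>simp_all add: coord_basis\<close>)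
  finally show ?thesis .
qed

text \<open>Both sides are bilinear, so agreement on basis vectors suffices.\<close>

lemma coord_bracket:
  assumes "2 \<le> n" "k \<le> n"
  shows "coord k (bracket u v) = s3_coord (\<lambda>l. coord l u) (\<lambda>l. coord l v) k"
proof (induction u rule: basis_induct)
  case (basis i)
  show ?case
  proof (induction v rule: basis_induct)
    case (basis j)
    then show ?case using assms \<open>i \<le> n\<close> by (simp add: coord_bracket_basis)
  qed (simp_all add: bracket_add_right bracket_scale_right coord_add coord_scale
      s3_coord_add_right s3_coord_scale_right)
qed (simp_all add: bracket_add_left bracket_scale_left coord_add coord_scale
      s3_coord_add_left s3_coord_scale_left)

end

section \<open>Coefficients of a half-derivation\<close>

locale lie_s3_half_derivation = lie_s3 scale bracket n e x
  for scale :: "complex \<Rightarrow> 'a::ab_group_add \<Rightarrow> 'a" and bracket n e x +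
  fixes \<phi> :: "'a \<Rightarrow> 'a"
  assumes n4: "4 \<le> n" and half: "half_derivation \<phi>"
begin

lemma coord_half_derivation:
  assumes "k \<le> n"
  shows "coord k (\<phi> (bracket u v)) =
    (s3_coord (\<lambda>l. coord l (\<phi> u)) (\<lambda>l. coord l v) k
      + s3_coord (\<lambda>l. coord l u) (\<lambda>l. coord l (\<phi> v)) k) / 2"
  using half assms n4
  by (simp add: half_derivation_def coord_scale coord_add coord_bracket)

lemma \<phi>_add: "\<phi> (u + v) = \<phi> u + \<phi> v"
  using half by (simp add: half_derivation_def Vector_Spaces.linear_iff)

lemma \<phi>_scale: "\<phi> (scale c u) = scale c (\<phi> u)"
  using half by (simp add: half_derivation_def Vector_Spaces.linear_iff)

text \<open>The identity for [e_i, x] at index k. The \<open>k = 2\<close> term comes from [e_1, x]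
  = e_1 + e_2; the last two come from [e_i, \<phi> x], where x yields e_i and e_1 yields
  e_{i+1}.\<close>

lemma coord_\<phi>_ei_x:
  assumes "2 \<le> i" "i \<le> n" "k \<le> n"
  shows "(of_nat i - 1) * coord k (\<phi> (e i)) =
    (if k = 0 then 0 else if k = 1 then coord 1 (\<phi> (e i)) / 2
     else ((of_nat k - 1) * coord k (\<phi> (e i)) + (if k = 2 then coord 1 (\<phi> (e i)) else 0)
       + (if k = i then (of_nat i - 1) * coord 0 (\<phi> x) else 0)
       + (if k = i + 1 then coord 1 (\<phi> x) else 0)) / 2)"
  using coord_half_derivation[OF assms(3), of "e i" x] assms n4
  by (auto simp: bracket_ei_x \<phi>_scale coord_scale s3_coord_def coord_e coord_x)

text \<open>At i = 2, k = 3 the weights i-1 and (k-1)/2 agree, so the e_3-coefficient of \<phi> e_2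
  cancels.\<close>

lemma coord_1_\<phi>_x: "coord 1 (\<phi> x) = 0"
  using coord_\<phi>_ei_x[of 2 3] n4 by simp

lemma coord_\<phi>_e:
  assumes i: "2 \<le> i" "i \<le> n" and k: "k \<le> n" "k \<noteq> 2 * i - 1"
  shows "coord k (\<phi> (e i)) = (if k = i then coord 0 (\<phi> x) else 0)"
proof -
  \<comment> \<open>These factors multiply the unknown coefficient for k = 0, k = 1 and k >= 2; the
    last vanishes only at the excluded k = 2i-1.\<close>
  have i1: "(of_nat i - 1 :: complex) \<noteq> 0" and i3: "(2 * of_nat i - 3 :: complex) \<noteq> 0"
    and ki: "(2 * of_nat i - of_nat k - 1 :: complex) \<noteq> 0"
  proof -
    show "(of_nat i - 1 :: complex) \<noteq> 0" using i by auto
    have "(of_nat (2 * i) :: complex) \<noteq> of_nat 3" by (subst of_nat_eq_iff) presburger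
    then show "(2 * of_nat i - 3 :: complex) \<noteq> 0" by simp
    have "(of_nat (2 * i) :: complex) \<noteq> of_nat (k + 1)"
      using i k by (subst of_nat_eq_iff) linarith
    then show "(2 * of_nat i - of_nat k - 1 :: complex) \<noteq> 0" by (simp add: algebra_simps)
  qed
  \<comment> \<open>Index 1 comes first because its coefficient enters the equation for k =
    2.\<close>
  have "(2 * of_nat i - 3) * coord 1 (\<phi> (e i)) = 0"
    using coord_\<phi>_ei_x[of i 1] i n4 by (simp add: algebra_simps)
  then have one: "coord 1 (\<phi> (e i)) = 0" using i3 by simp
  consider "k = 0" | "k = 1" | "2 \<le> k" by linarith
  then show ?thesis
  proof cases
    case 1
    then show ?thesis using coord_\<phi>_ei_x[of i 0] i i1 by simp
  next
    case 2
    then show ?thesis using one i by simp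
  next
    case 3
    have "(2 * of_nat i - of_nat k - 1) * coord k (\<phi> (e i))
        = (if k = i then (2 * of_nat i - of_nat k - 1) * coord 0 (\<phi> x) else 0)"
      using coord_\<phi>_ei_x[of i k] i k 3 one coord_1_\<phi>_x by (simp add: field_simps split: if_splits)
    then show ?thesis using ki by (simp split: if_splits)
  qed
qed

text \<open>The identity for [e_i, e_1] at index k. Only [e_i, \<phi> e_1] is expanded, so that any
  knowledge of \<phi> e_i can be inserted later.\<close>

lemma coord_\<phi>_ei_e1:
  assumes "2 \<le> i" "i < n" "k \<le> n"
  shows "coord k (\<phi> (e (i + 1))) =
    s3_coord (\<lambda>l. coord l (\<phi> (e i))) (\<lambda>l. coord l (e 1)) k / 2
      + ((if k = i then (of_nat i - 1) * coord 0 (\<phi> (e 1)) else 0)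
       + (if k = i + 1 then coord 1 (\<phi> (e 1)) else 0)) / 2"
proof -
  have "s3_coord (\<lambda>l. coord l (e i)) (\<lambda>l. coord l (\<phi> (e 1))) k =
      (if k = i then (of_nat i - 1) * coord 0 (\<phi> (e 1)) else 0)
       + (if k = i + 1 then coord 1 (\<phi> (e 1)) else 0)"
  proof -
    consider "k = i" | "k = i + 1" | "k \<noteq> i" "k \<noteq> i + 1" by blast
    then show ?thesis
    proof cases
      case 3
      \<comment> \<open>For k = 0 the truncated \<open>k - 1\<close> is 0, still different from i >=
        2.\<close>
      then have "i \<noteq> k - 1" using assms by linarith
      with 3 show ?thesis using assms by (simp add: s3_coord_def coord_e)
    qed (use assms in \<open>auto simp: s3_coord_def coord_e\<close>)
  qed
  then show ?thesis
    using coord_half_derivation[OF assms(3), of "e i" "e 1"] assms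
    by (simp only: bracket_ei_e1 add_divide_distrib)
qed

text \<open>In the identity for [e_2, e_1], neither \<phi> e_3 nor [\<phi> e_2, e_1] has an
  e_2-component, but an x-component of \<phi> e_1 would produce one.\<close>

lemma coord_0_\<phi>_e1: "coord 0 (\<phi> (e 1)) = 0"
  using coord_\<phi>_ei_e1[of 2 2] coord_\<phi>_e[of 3 2] coord_\<phi>_e[of 2 0] coord_\<phi>_e[of 2 1]
    coord_\<phi>_e[of 2 2] n4
  by (simp add: s3_coord_def coord_e)

lemma coord_1_\<phi>_e1: "coord 1 (\<phi> (e 1)) = coord 0 (\<phi> x)"
proof -
  \<comment> \<open>The same identity, read at e_3.\<close>
  have "coord 0 (\<phi> x) = coord 0 (\<phi> x) / 2 + coord 1 (\<phi> (e 1)) / 2"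
    using coord_\<phi>_ei_e1[of 2 3] coord_\<phi>_e[of 3 3] coord_\<phi>_e[of 2 0] coord_\<phi>_e[of 2 2] n4
    by (simp add: s3_coord_def coord_e)
  then show ?thesis by (simp add: field_simps)
qed

text \<open>Bracketing with e_1 shifts e_3 to e_4, which exists as \<open>4 \<le> n\<close>, while
  \<phi> e_3 has no e_4-component: its exceptional index is 5.\<close>

lemma coord_3_\<phi>_e2: "coord 3 (\<phi> (e 2)) = 0"
  using coord_\<phi>_ei_e1[of 2 4] coord_\<phi>_e[of 3 4] coord_\<phi>_e[of 2 0] coord_\<phi>_e[of 2 4] n4
  by (simp add: s3_coord_def coord_e)

lemma \<phi>_e:
  assumes "2 \<le> i" "i \<le> n"
  shows "\<phi> (e i) = scale (coord 0 (\<phi> x)) (e i)"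
  using assms
proof (induction i rule: dec_induct)
  case base
  show ?case
  proof (rule coord_eqI)
    fix k assume "k \<le> n"
    \<comment> \<open>For i = 2 the exceptional index 2i-1 is 3.\<close>
    then show "coord k (\<phi> (e 2)) = coord k (scale (coord 0 (\<phi> x)) (e 2))"
      using coord_\<phi>_e[of 2 k] coord_3_\<phi>_e2 n4 by (cases "k = 3") (auto simp: coord_scale coord_e)
  qed
next
  case (step i)
  show ?case
  proof (rule coord_eqI)
    fix k assume "k \<le> n"
    \<comment> \<open>[\<phi> e_i, e_1] and [e_i, \<phi> e_1] both equal q e_{i+1}, and so does half
      their sum.\<close>
    then show "coord k (\<phi> (e (Suc i))) = coord k (scale (coord 0 (\<phi> x)) (e (Suc i)))"
      using coord_\<phi>_ei_e1[of i k] step coord_0_\<phi>_e1 coord_1_\<phi>_e1 n4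
      by (auto simp: coord_scale coord_e s3_coord_def)
  qed
qed

text \<open>Since [e_1, e_{k-1}] = -e_k for k >= 3, index k sees the coefficient of \<phi> x at k-1.
  As k <= n, its e_n-coefficient is never reached and stays free.\<close>

lemma coord_\<phi>_e1_x:
  assumes "2 \<le> k" "k \<le> n"
  shows "if k = 2 then coord 2 (\<phi> (e 1)) = 0
    else coord (k - 1) (\<phi> x) = (of_nat k - 3) * coord k (\<phi> (e 1))"
  using coord_half_derivation[OF assms(2), of "e 1" x] \<phi>_e[of 2] assms n4 coord_0_\<phi>_e1
    coord_1_\<phi>_e1 coord_1_\<phi>_x
  by (auto simp: bracket_e1_x \<phi>_add coord_add coord_scale s3_coord_def coord_e coord_x field_simps
      simp del: One_nat_def)

lemma \<phi>_e1:
  "\<phi> (e 1) = scale (coord 1 (\<phi> (e 1))) (e 1) + (\<Sum>i=3..n. scale (coord i (\<phi> (e 1))) (e i))"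
  (is "_ = ?r")
proof (rule coord_eqI)
  fix k assume k: "k \<le> n"
  consider "k = 0" | "k = 1" | "k = 2" | "3 \<le> k" by linarith
  then show "coord k (\<phi> (e 1)) = coord k ?r"
    by cases (use k n4 coord_0_\<phi>_e1 coord_\<phi>_e1_x[of 2]
        in \<open>auto simp: coord_add coord_scale coord_e coord_sum_e\<close>)
qed

lemma \<phi>_x:
  "\<phi> x = (\<Sum>i=3..n - 1. scale ((of_nat i - 2) * coord (i + 1) (\<phi> (e 1))) (e i))
     + scale (coord n (\<phi> x)) (e n) + scale (coord 1 (\<phi> (e 1))) x"
  (is "_ = ?r")
proof (rule coord_eqI)
  fix k assume k: "k \<le> n"
  have r: "coord k ?r = (if 3 \<le> k \<and> k \<le> n - 1 then (of_nat k - 2) * coord (k + 1) (\<phi> (e 1)) else 0)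
      + (if k = n then coord n (\<phi> x) else 0) + (if k = 0 then coord 0 (\<phi> x) else 0)"
    using k n4 coord_1_\<phi>_e1 by (auto simp: coord_add coord_scale coord_e coord_x coord_sum_e)
  consider "k = 0" | "k = 1" | "k = n" | "2 \<le> k" "k < n" using k by linarith
  then show "coord k (\<phi> x) = coord k ?r"
  proof cases
    case 4
    \<comment> \<open>At \<open>k + 1\<close> the factor is k-2, so the e_2-term drops out and the
      sum starts at 3.\<close>
    then show ?thesis
      unfolding r using coord_\<phi>_e1_x[of "k + 1"] by (cases "k = 2") auto
  qed (unfold r, use n4 coord_1_\<phi>_x in auto)
qed

end

theorem theorem2p3:
  fixes scale :: "complex \<Rightarrow> 'a::ab_group_add \<Rightarrow> 'a"
    and bracket :: "'a \<Rightarrow> 'a \<Rightarrow> 'a"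
    and n :: nat and e :: "nat \<Rightarrow> 'a" and x :: 'a
    and \<phi> :: "'a \<Rightarrow> 'a"
  assumes "n \<ge> 4"
    and "lie_s3 scale bracket n e x"
    and "complex_lie_algebra.half_derivation scale bracket \<phi>"
  shows "\<exists>(\<alpha> :: nat \<Rightarrow> complex) (\<delta>\<^sub>n :: complex).
      \<phi> (e 1) = scale (\<alpha> 1) (e 1) + (\<Sum>i=3..n. scale (\<alpha> i) (e i)) \<and>
      (\<forall>i\<in>{2..n}. \<phi> (e i) = scale (\<alpha> 1) (e i)) \<and>
      \<phi> x = (\<Sum>i=3..n - 1. scale ((of_nat i - 2) * \<alpha> (i + 1)) (e i))
             + scale \<delta>\<^sub>n (e n) + scale (\<alpha> 1) x"
proof -
  interpret lie_s3 scale bracket n e x by (rule assms(2))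
  interpret lie_s3_half_derivation scale bracket n e x \<phi>
    by unfold_locales (rule assms)+
  have "\<forall>i\<in>{2..n}. \<phi> (e i) = scale (coord 1 (\<phi> (e 1))) (e i)"
    using \<phi>_e coord_1_\<phi>_e1 by simp
  \<comment> \<open>The \<alpha>'s are the coordinates of \<phi> e_1; the last witness is the free
    e_n-coefficient of \<phi> x.\<close>
  with \<phi>_e1 \<phi>_x show ?thesis
    by (intro exI[of _ "\<lambda>i. coord i (\<phi> (e 1))"] exI[of _ "coord n (\<phi> x)"] conjI)
qed

end
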